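(* Let $G$ be any abelian group written additively, and let $\psi_1,\ldots,\psi_k$ be maps from $\mathbb{Z}$ to $G$ with periods $n_1,\ldots,n_k\in\mathbb{Z}^+$ respectively. Set $\psi=\psi_1+\cdots+\psi_k$ and $$S(n_1,\ldots,n_k)=\bigcup_{s=1}^k\left\{\frac{r}{n_s}:\ r=0,\ldots,n_s-1\right\}.$$ (i) There are periodic maps $f_0,\ldots,f_{|S(n_1,\ldots,n_k)|-1}:\mathbb{Z}\to\mathbb{Z}$, depending only on the set $S(n_1,\ldots,n_k)$ (in particular, not on $G$ or on $\psi_1,\ldots,\psi_k$), such that $$\psi(x)=\sum_{0\leqslant r<|S(n_1,\ldots,n_k)|}f_r(x)\psi(r)\quad\text{for all } x\in\mathbb{Z}.$$ In particular, the values of $\psi$ are completely determined by the set $S(n_1,\ldots,n_k)$ and the initial values $\psi(0),\ldots,\psi(|S(n_1,\ldots,n_k)|-1)$. (ii) $\psi$ is constant if $\psi(x)$ equals a constant for $|S(n_1,\ldots,n_k)|$ consecutive integers $x$; moreover $|S(n_1,\ldots,n_k)|\leqslant n_1+\cdots+n_k-k+1$.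
   Context: $\mathbb{Z}^+=\{1,2,3,\ldots\}$. A map $f$ on $\mathbb{Z}$ has period $n\in\mathbb{Z}^+$ if $f(x+n)=f(x)$ for all $x\in\mathbb{Z}$ ($n$ need not be the least period); $f$ is periodic if it has some positive period. $|S|$ denotes the cardinality of a finite set $S$. "Depending only on $S(n_1,\ldots,n_k)$" means that a single choice of $f_0,\ldots,f_{|S|-1}$, attached to the set $S$, works for all $k$ and all $n_1,\ldots,n_k$ with $S(n_1,\ldots,n_k)=S$, all abelian groups $G$, and all $\psi_1,\ldots,\psi_k$ as in the hypotheses. *)

theory Defs
  imports "HOL-Analysis.Analysis" "HOL-Library.Periodic_Fun"
begin

definition has_period :: "(int \<Rightarrow> 'a) \<Rightarrow> nat \<Rightarrow> bool" where
  "has_period f n \<longleftrightarrow> n > 0 \<and> periodic_fun_simple f (int n)"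

definition periodic_map :: "(int \<Rightarrow> 'a) \<Rightarrow> bool" where
  "periodic_map f \<longleftrightarrow> (\<exists>n. has_period f n)"

definition periodic_system :: "nat \<Rightarrow> (nat \<Rightarrow> nat) \<Rightarrow> (nat \<Rightarrow> int \<Rightarrow> 'a) \<Rightarrow> bool" where
  "periodic_system k n \<psi> \<longleftrightarrow> k \<ge> 1 \<and> (\<forall>s\<in>{1..k}. has_period (\<psi> s) (n s))"

definition total_map :: "nat \<Rightarrow> (nat \<Rightarrow> int \<Rightarrow> 'g) \<Rightarrow> int \<Rightarrow> 'g::ab_group_add" where
  "total_map k \<psi> x = (\<Sum>s=1..k. \<psi> s x)"

definition fraction_set :: "nat \<Rightarrow> (nat \<Rightarrow> nat) \<Rightarrow> rat set" where
  "fraction_set k n = (\<Union>s\<in>{1..k}. {of_nat r / of_nat (n s) | r. r < n s})"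

text \<open>The integer multiple \<open>m g\<close> in an additive abelian group; at most one of the two
  sums is nonempty.\<close>

definition int_multiple :: "int \<Rightarrow> 'g \<Rightarrow> 'g::ab_group_add" where
  "int_multiple m g = (\<Sum>i<nat m. g) - (\<Sum>i<nat (- m). g)"

text \<open>
  The maps \<open>f\<^sub>0, \<dots>, f\<^bsub>|S|-1\<^esub>\<close> attached to \<open>S\<close>.
  A formula of HOL cannot quantify over all abelian groups (types), so in a statement of the form
  ``there are maps \<open>f\<^sub>r\<close> such that \dots'' about maps into \<open>'g\<close> the \<open>f\<^sub>r\<close> could depend
  on \<open>'g\<close>. To express that a single choice serves all groups, the choice is made once and for
  all by a constant whose type and arguments do not mention the group. The choice operator selects
  any family that works for integer-valued maps. That such a family exists, and that the selected
  one works for every abelian group, is not built into the definition and has to be proved.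
  If \<open>S\<close> is not of the form \<open>fraction_set k n\<close> with positive \<open>n s\<close>, the value is irrelevant.
\<close>

definition coefficient_maps :: "rat set \<Rightarrow> nat \<Rightarrow> int \<Rightarrow> int" where
  "coefficient_maps S = (SOME f.
     (\<forall>r<card S. periodic_map (f r)) \<and>
     (\<forall>k n (\<psi> :: nat \<Rightarrow> int \<Rightarrow> int). periodic_system k n \<psi> \<and> fraction_set k n = S \<longrightarrow>
        (\<forall>x. total_map k \<psi> x = (\<Sum>r<card S. f r x * total_map k \<psi> (int r)))))"

end

theory Submission
  imports Defs "HOL-Computational_Algebra.Polynomial_Factorial"
begin

text \<open>
  Let \<open>L\<close> be the least common multiple of the polynomials \<open>z^(n s) - 1\<close> over the integers. It is monic
  and divides some \<open>z^N - 1\<close>, so its complex roots are simple; they are the \<open>exp (2 \<pi> i q)\<close> with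
  \<open>q \<in> S\<close>, whence \<open>degree L = card S\<close>. A sequence of period \<open>n s\<close> is annihilated by every multiple
  of \<open>z^(n s) - 1\<close> read as a linear recurrence, so \<open>\<psi>\<close> is annihilated by every multiple of \<open>L\<close>, and
  the coefficients of the remainder of \<open>z^(x mod N)\<close> modulo \<open>L\<close> can serve as the values
  \<open>f r x\<close>. The constancy criterion follows by shifting \<open>\<psi>\<close> and subtracting the constant.
\<close>

section \<open>The polynomials \<open>z^m - 1\<close> and their least common multiple\<close>

abbreviation unity_poly :: "nat \<Rightarrow> 'a::comm_ring_1 poly" where
  "unity_poly m \<equiv> monom 1 m - 1"

lemma unity_poly_dvd:
  assumes "m dvd n"
  shows "unity_poly m dvd unity_poly n"
proof -
  obtain c where c: "n = m * c" using assms by blast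
  have "monom 1 n - 1 = (monom 1 m :: 'a poly) ^ c - 1"
    by (simp add: monom_power c mult.commute)
  then show ?thesis
    by (metis dvd_triv_left power_diff_1_eq)
qed

lemma degree_unity_poly:
  assumes "m > 0"
  shows "degree (unity_poly m :: 'a::comm_ring_1 poly) = m"
proof -
  have "degree (monom 1 m + (- 1) :: 'a poly) = degree (monom 1 m :: 'a poly)"
    using assms by (intro degree_add_eq_left) (simp add: degree_monom_eq)
  then show ?thesis by (simp add: degree_monom_eq)
qed

lemma lead_coeff_unity_poly:
  assumes "m > 0"
  shows "lead_coeff (unity_poly m :: 'a::comm_ring_1 poly) = 1"
  using assms by (simp add: degree_unity_poly)

lemma map_poly_of_int_mult:
  "map_poly of_int (p * q) =
    (map_poly of_int p * map_poly of_int q :: 'a::comm_ring_1 poly)"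
  by (intro poly_eqI) (simp add: coeff_map_poly coeff_mult)

lemma map_poly_of_int_unity_poly:
  "map_poly of_int (unity_poly m) = (unity_poly m :: 'a::comm_ring_1 poly)"
  by (intro poly_eqI) (simp add: coeff_map_poly)

lemma poly_of_int_dvd_root:
  fixes z :: "'a::comm_ring_1"
  assumes "p dvd q" "poly (map_poly of_int p) z = 0"
  shows "poly (map_poly of_int q) z = 0"
  using assms by (auto simp: map_poly_of_int_mult)

lemma poly_of_int_prod_root:
  fixes z :: "'a::idom"
  assumes "finite A" "poly (map_poly of_int (\<Prod>a\<in>A. p a)) z = 0"
  shows "\<exists>a\<in>A. poly (map_poly of_int (p a)) z = 0"
  using assms by (induction A rule: finite_induct) (auto simp: map_poly_of_int_mult)

text \<open>Taking the lcm over the integers and making it monic lets later division by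
  \<open>L\<close> stay within integer coefficients; complex numbers enter only to count its
  roots.\<close>

lemma monic_lcm_unity_poly:
  assumes "finite A" "\<And>m. m \<in> A \<Longrightarrow> m > 0"
  obtains L :: "int poly" where
    "lead_coeff L = 1"
    "\<forall>m\<in>A. unity_poly m dvd L"
    "degree L = card (\<Union>m\<in>A. {z::complex. z ^ m = 1})"
proof -
  define M where "M = Lcm (unity_poly ` A :: int poly set)"
  \<comment> \<open>The leading coefficient of \<open>M\<close> turns out to be 1 or -1, so
    multiplying by it makes \<open>M\<close> monic and changes neither degree nor
    divisibility.\<close>
  define L where "L = smult (lead_coeff M) M"
  define N where "N = \<Prod>A"
  have N: "N > 0" using assms by (simp add: N_def prod_pos)
  have "M dvd unity_poly N"
    unfolding M_def
    by (rule Lcm_least) (use assms(1) in \<open>auto simp: N_def intro!: unity_poly_dvd dvd_prodI\<close>)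
  then obtain Q where Q: "unity_poly N = M * Q" by blast
  have "lead_coeff M * lead_coeff Q = 1"
    using lead_coeff_unity_poly[OF N, where ?'a = int] unfolding Q by (simp add: lead_coeff_mult)
  then have lM: "lead_coeff M * lead_coeff M = 1" "M \<noteq> 0" "Q \<noteq> 0"
    by (auto simp: zmult_eq_1_iff)
  have "lead_coeff L = 1" using lM by (simp add: L_def)
  moreover have dvd_L: "M dvd L" by (simp add: L_def dvd_smult)
  moreover have dvd: "unity_poly m dvd L" if "m \<in> A" for m
    using that dvd_L dvd_Lcm[of "unity_poly m" "unity_poly ` A :: int poly set"]
    unfolding M_def by (meson dvd_trans imageI)
  moreover have "degree L = card (\<Union>m\<in>A. {z::complex. z ^ m = 1})"
  proof -
    define h where "h = (map_poly of_int :: int poly \<Rightarrow> complex poly)"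
    define R where "R = (\<lambda>p. {z. poly (h p) z = 0})"
    have degh: "degree (h p) = degree p" for p
      by (cases "p = 0") (auto simp: h_def intro: map_poly_degree_eq)
    have hne: "h p \<noteq> 0" if "p \<noteq> 0" for p
      using that by (simp add: h_def map_poly_eq_0_iff)
    have Rle: "finite (R p)" "card (R p) \<le> degree p" if "p \<noteq> 0" for p
      using hne[OF that] Polynomial.card_poly_roots_bound[of "h p"] poly_roots_finite[of "h p"]
      by (auto simp: R_def degh)
    have Ru: "R (unity_poly m) = {z. z ^ m = 1}" for m
      by (auto simp: R_def h_def map_poly_of_int_unity_poly poly_monom)
    \<comment> \<open>All \<open>N\<close> roots of \<open>z^N - 1\<close> are distinct and each is
      a root of \<open>M\<close> or \<open>Q\<close>. As \<open>Q\<close> has at most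
      \<open>degree Q\<close> of them, at least \<open>N - degree Q = degree M\<close> are left for
      \<open>M\<close>, which cannot have more.\<close>
    have "N = card (R (unity_poly N))"
      using card_roots_unity_eq[OF N] by (simp add: Ru)
    also have "R (unity_poly N) = R M \<union> R Q"
      unfolding Q by (auto simp: R_def h_def map_poly_of_int_mult)
    also have "card \<dots> \<le> card (R M) + card (R Q)" by (rule card_Un_le)
    finally have "N \<le> card (R M) + degree Q" using Rle(2)[of Q] lM by linarith
    moreover have "N = degree M + degree Q"
      using degree_unity_poly[OF N, where ?'a = int] lM unfolding Q by (simp add: degree_mult_eq)
    ultimately have "degree M = card (R M)" using Rle(2)[of M] lM by linarith
    moreover have "R M = (\<Union>m\<in>A. R (unity_poly m))"
    proof
      \<comment> \<open>The product of the \<open>z^m - 1\<close> is a common multiple, so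
        \<open>M\<close> has no roots beyond theirs; the converse inclusion holds because each
        factor divides \<open>M\<close>.\<close>
      have "M dvd (\<Prod>m\<in>A. unity_poly m)"
        unfolding M_def by (rule Lcm_least) (use assms(1) in \<open>auto intro: dvd_prodI\<close>)
      then show "R M \<subseteq> (\<Union>m\<in>A. R (unity_poly m))"
        using poly_of_int_dvd_root poly_of_int_prod_root[OF assms(1)]
        unfolding R_def h_def by blast
      have "unity_poly m dvd M" if "m \<in> A" for m
        unfolding M_def using that by (intro dvd_Lcm) auto
      then show "(\<Union>m\<in>A. R (unity_poly m)) \<subseteq> R M"
        using poly_of_int_dvd_root unfolding R_def h_def by blast
    qed
    moreover have "degree L = degree M" using lM by (simp add: L_def)
    ultimately show ?thesis by (simp add: Ru)
  qed
  ultimately show ?thesis using that by blast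
qed

section \<open>Fractions as roots of unity, and the size of the fraction set\<close>

lemma bij_betw_fractions_roots_unity:
  assumes "n > 0"
  shows "bij_betw (\<lambda>q. cis (2 * pi * of_rat q)) {of_nat r / of_nat n | r. r < n} {z. z ^ n = 1}"
proof -
  let ?e = "\<lambda>q. cis (2 * pi * of_rat q)" and ?g = "\<lambda>r. of_nat r / of_nat n :: rat"
  have "bij_betw (?e \<circ> ?g) {..<n} {z. z ^ n = 1}"
    using Complex.bij_betw_roots_unity[OF assms] by (simp add: o_def of_rat_divide)
  then have "bij_betw ?e (?g ` {..<n}) {z. z ^ n = 1}"
    unfolding bij_betw_def by (auto intro: inj_on_imageI simp: image_comp)
  moreover have "?g ` {..<n} = {of_nat r / of_nat n | r. r < n}" by auto
  ultimately show ?thesis by simp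
qed

lemma fractions_mono:
  assumes "m dvd n" "n > 0"
  shows "{of_nat r / of_nat m | r. r < m} \<subseteq> {of_nat r / of_nat n :: rat | r. r < n}"
proof clarify
  fix r assume r: "r < m"
  obtain c where c: "n = m * c" using assms by blast
  with assms r have "r * c < n" "of_nat r / of_nat m = (of_nat (r * c) / of_nat n :: rat)"
    by (auto simp: field_simps)
  then show "\<exists>r'. of_nat r / of_nat m = (of_nat r' / of_nat n :: rat) \<and> r' < n" by blast
qed

text \<open>The map \<open>q\<close> to \<open>exp (2 \<pi> i q)\<close> carries each set of
  fractions onto the corresponding roots of unity. It is injective on the union because all the
  fractions can be written over the common denominator \<open>N\<close>.\<close>

lemma card_fraction_set:
  assumes "\<And>s. s \<in> {1..k} \<Longrightarrow> n s > 0"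
  shows "card (fraction_set k n) = card (\<Union>m\<in>n ` {1..k}. {z::complex. z ^ m = 1})"
proof -
  let ?e = "\<lambda>q. cis (2 * pi * of_rat q)" and ?F = "\<lambda>m. {of_nat r / of_nat m :: rat | r. r < m}"
  define N where "N = prod n {1..k}"
  have N: "N > 0" using assms by (auto simp: N_def intro: prod_pos)
  have "fraction_set k n \<subseteq> ?F N"
    unfolding fraction_set_def
    by (intro UN_least fractions_mono N) (auto simp: N_def intro: dvd_prodI)
  then have inj: "inj_on ?e (fraction_set k n)"
    using bij_betw_fractions_roots_unity[OF N] unfolding bij_betw_def by (blast intro: inj_on_subset)
  have "?e ` ?F (n s) = {z. z ^ n s = 1}" if "s \<in> {1..k}" for s
    using bij_betw_fractions_roots_unity assms[OF that] unfolding bij_betw_def by blast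
  then have "?e ` fraction_set k n = (\<Union>m\<in>n ` {1..k}. {z. z ^ m = 1})"
    unfolding fraction_set_def image_UN by simp
  with card_image[OF inj] show ?thesis by simp
qed

text \<open>The fraction 0 is shared by all \<open>s\<close>, so it is counted once, and each
  \<open>s\<close> adds at most \<open>n s - 1\<close> nonzero fractions.\<close>

lemma card_fraction_set_le:
  assumes "k \<ge> 1" "\<And>s. s \<in> {1..k} \<Longrightarrow> n s > 0"
  shows "int (card (fraction_set k n)) \<le> (\<Sum>s=1..k. int (n s)) - int k + 1"
proof -
  let ?g = "\<lambda>s r. of_nat r / of_nat (n s) :: rat"
  have "fraction_set k n \<subseteq> insert 0 (\<Union>s\<in>{1..k}. ?g s ` {1..<n s})"
  proof
    fix q assume "q \<in> fraction_set k n"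
    then obtain s r where "s \<in> {1..k}" "r < n s" "q = ?g s r"
      by (auto simp: fraction_set_def)
    then show "q \<in> insert 0 (\<Union>s\<in>{1..k}. ?g s ` {1..<n s})"
      by (cases "r = 0") force+
  qed
  then have "card (fraction_set k n) \<le> card (insert 0 (\<Union>s\<in>{1..k}. ?g s ` {1..<n s}))"
    by (intro card_mono) auto
  also have "\<dots> \<le> Suc (card (\<Union>s\<in>{1..k}. ?g s ` {1..<n s}))"
    by (simp add: card_insert_if)
  also have "\<dots> \<le> Suc (\<Sum>s=1..k. card (?g s ` {1..<n s}))"
    by (simp add: card_UN_le)
  also have "\<dots> \<le> Suc (\<Sum>s=1..k. n s - 1)"
    using card_image_le[of "{1..<n _}"] by (auto intro!: sum_mono)
  finally have "int (card (fraction_set k n)) \<le> int (Suc (\<Sum>s=1..k. n s - 1))"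
    by linarith
  also have "\<dots> = 1 + (\<Sum>s=1..k. int (n s - 1))" by simp
  \<comment> \<open>Truncated subtraction is exact here since every \<open>n s\<close> is
    positive.\<close>
  also have "(\<Sum>s=1..k. int (n s - 1)) = (\<Sum>s=1..k. int (n s) - 1)"
    using assms(2) by (intro sum.cong) (auto simp: Suc_le_eq of_nat_diff)
  also have "\<dots> = (\<Sum>s=1..k. int (n s)) - int k" by (simp add: sum_subtractf)
  finally show ?thesis by simp
qed

text \<open>The fraction \<open>(n s - 1) / n s\<close> is reduced, so its denominator divides
  whichever \<open>n' t\<close> produces it.\<close>

lemma fraction_set_eq_imp_dvd:
  assumes "fraction_set k n = fraction_set k' n'"
    and "s \<in> {1..k}" "n s > 0" "\<And>t. t \<in> {1..k'} \<Longrightarrow> n' t > 0"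
  shows "\<exists>t\<in>{1..k'}. n s dvd n' t"
proof -
  have "of_nat (n s - 1) / of_nat (n s) \<in> fraction_set k n"
    using assms(2,3) unfolding fraction_set_def
    by (intro UN_I[of s] CollectI exI[of _ "n s - 1"]) auto
  then obtain t r where t: "t \<in> {1..k'}"
    and "of_nat (n s - 1) / of_nat (n s) = (of_nat r / of_nat (n' t) :: rat)"
    unfolding assms(1) by (auto simp: fraction_set_def)
  then have "of_nat ((n s - 1) * n' t) = (of_nat (r * n s) :: rat)"
    using assms(3) assms(4)[OF t] by (simp add: field_simps)
  then have "(n s - 1) * n' t = r * n s" by (rule of_nat_eq_iff[THEN iffD1])
  then have "n s dvd (n s - 1) * n' t" by simp
  moreover have "coprime (n s) (n s - 1)"
    using assms(3) by (metis coprime_commute coprime_diff_one_left_nat)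
  ultimately show ?thesis
    using t by (auto simp: coprime_dvd_mult_right_iff)
qed

section \<open>Periodic sequences as solutions of recurrences, and the integer coefficients\<close>

lemma has_period_mult:
  assumes "has_period f m"
  shows "f (x + int m * j) = f x"
proof -
  interpret periodic_fun_simple f "int m" using assms by (simp add: has_period_def)
  show ?thesis using plus_of_int[of x j] by (simp add: mult.commute)
qed

lemma has_period_mod:
  assumes "has_period f m" "m dvd N"
  shows "f (x mod int N) = f x"
proof -
  obtain c where "N = m * c" using assms(2) by blast
  then have "x mod int N + int m * (int c * (x div int N)) = x"
    by (simp add: mult.assoc[symmetric])
  then show ?thesis using has_period_mult[OF assms(1)] by metis
qed

text \<open>Multiplying a polynomial by \<open>z^m\<close> shifts its coefficients by
  \<open>m\<close>, which \<open>g\<close> does not notice; hence the two parts of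
  \<open>(z^m - 1) * q\<close> contribute the same sum and cancel.\<close>

lemma sum_coeff_periodic_eq_0:
  fixes p :: "int poly"
  assumes "has_period g m" "unity_poly m dvd p" "degree p \<le> B"
  shows "(\<Sum>i\<le>B. coeff p i * g (int i)) = 0"
proof -
  obtain q where q: "p = unity_poly m * q" using assms(2) by blast
  \<comment> \<open>With this choice \<open>m + D\<close> bounds \<open>B\<close> as well as the
    degrees of \<open>q\<close> and \<open>z^m * q\<close>, so all the sums can be taken over one
    range.\<close>
  define D where "D = B + degree q"
  have ext: "(\<Sum>i\<le>B'. coeff r i * g (int i)) = (\<Sum>i\<le>D'. coeff r i * g (int i))"
    if "degree r \<le> B'" "B' \<le> D'" for B' D' and r :: "int poly"
    using that by (intro sum.mono_neutral_left) (auto simp: coeff_eq_0)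
  have "(\<Sum>i\<le>B. coeff p i * g (int i)) = (\<Sum>i\<le>m + D. coeff p i * g (int i))"
    using assms(3) by (intro ext) (auto simp: D_def)
  also have "\<dots> = (\<Sum>i\<le>m + D. coeff (monom 1 m * q) i * g (int i))
      - (\<Sum>i\<le>m + D. coeff q i * g (int i))"
    by (simp add: q algebra_simps sum_subtractf)
  also have "(\<Sum>i\<le>m + D. coeff (monom 1 m * q) i * g (int i))
      = (\<Sum>i=m..m + D. coeff q (i - m) * g (int i))"
    by (intro sum.mono_neutral_cong_right) (auto simp: coeff_monom_mult)
  also have "\<dots> = (\<Sum>i\<le>D. coeff q i * g (int i + int m))"
    by (rule sum.reindex_bij_witness[of _ "\<lambda>i. i + m" "\<lambda>i. i - m"]) auto
  also have "\<dots> = (\<Sum>i\<le>D. coeff q i * g (int i))"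
    using has_period_mult[OF assms(1), of _ 1] by simp
  also have "\<dots> = (\<Sum>i\<le>m + D. coeff q i * g (int i))"
    by (rule ext) (auto simp: D_def)
  finally show ?thesis by simp
qed

text \<open>This is the predicate under the choice operator in
  \<open>coefficient_maps\<close>.\<close>

definition is_coefficient_family :: "rat set \<Rightarrow> (nat \<Rightarrow> int \<Rightarrow> int) \<Rightarrow> bool" where
  "is_coefficient_family S f \<longleftrightarrow>
     (\<forall>r<card S. periodic_map (f r)) \<and>
     (\<forall>k n (\<psi> :: nat \<Rightarrow> int \<Rightarrow> int). periodic_system k n \<psi> \<and> fraction_set k n = S \<longrightarrow>
        (\<forall>x. total_map k \<psi> x = (\<Sum>r<card S. f r x * total_map k \<psi> (int r))))"

text \<open>A family built from one presentation \<open>k\<close>, \<open>n\<close> of the set must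
  serve every other presentation \<open>k'\<close>, \<open>n'\<close>. It does, because each
  \<open>n' s\<close> divides some \<open>n t\<close>, so \<open>z^(n' s) - 1\<close> still divides
  \<open>L\<close>.\<close>

lemma ex_coefficient_family:
  assumes "k \<ge> 1" and pos: "\<And>s. s \<in> {1..k} \<Longrightarrow> n s > 0"
  shows "\<exists>f. is_coefficient_family (fraction_set k n) f"
proof -
  define d where "d = card (fraction_set k n)"
  have d_eq: "d = card (\<Union>m\<in>n ` {1..k}. {z::complex. z ^ m = 1})"
    unfolding d_def using pos by (rule card_fraction_set)
  have "finite (n ` {1..k})" "\<And>m. m \<in> n ` {1..k} \<Longrightarrow> m > 0"
    using pos by auto
  then obtain L :: "int poly" where L: "lead_coeff L = 1"
    "\<forall>m\<in>n ` {1..k}. unity_poly m dvd L" "degree L = d"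
    unfolding d_eq by (rule monic_lcm_unity_poly)
  have L0: "L \<noteq> 0" using L(1) by auto
  \<comment> \<open>Positivity of \<open>d\<close> is what makes the bound
    \<open>degree (R y) < d\<close> true also for a zero remainder, whose degree is 0.\<close>
  have "0 \<in> fraction_set k n"
    using assms(1) pos[of 1] unfolding fraction_set_def by force
  moreover have "finite (fraction_set k n)" by (simp add: fraction_set_def)
  ultimately have d: "d > 0" unfolding d_def by (auto simp: card_gt_0_iff)
  define N where "N = prod n {1..k}"
  have N: "N > 0" using pos by (auto simp: N_def intro: prod_pos)
  \<comment> \<open>Since \<open>L\<close> is monic, the scaling factor in pseudo-division is 1, and
    this is ordinary division with remainder over the integers.\<close>
  define R where "R y = snd (pseudo_divmod (monom 1 y) L)" for y
  have dvdR: "L dvd monom 1 y - R y" for y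
  proof -
    have "monom 1 y = L * fst (pseudo_divmod (monom 1 y) L) + R y"
      using pseudo_divmod(1)[OF L0 prod.collapse[symmetric], of "monom 1 y"] L(1)
      by (simp add: R_def)
    then show ?thesis by (metis add_diff_cancel_right' dvd_triv_left)
  qed
  have degR: "degree (R y) < d" for y
    using pseudo_divmod(2)[OF L0 prod.collapse[symmetric], of "monom 1 y"] L(3) d
    by (auto simp: R_def)
  \<comment> \<open>Reducing \<open>x\<close> modulo \<open>N\<close> gives a nonnegative exponent
    even for negative \<open>x\<close> and makes \<open>f r\<close> periodic.\<close>
  define f where "f r x = coeff (R (nat (x mod int N))) r" for r and x :: int
  have "has_period (f r) N" for r
    using N by (simp add: has_period_def periodic_fun_simple_def f_def)
  then have "periodic_map (f r)" for r unfolding periodic_map_def by blast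
  moreover have "total_map k' \<psi> x = (\<Sum>r<d. f r x * total_map k' \<psi> (int r))"
    if sys: "periodic_system k' n' \<psi>" and S: "fraction_set k' n' = fraction_set k n"
    for k' n' x and \<psi> :: "nat \<Rightarrow> int \<Rightarrow> int"
  proof -
    define y where "y = nat (x mod int N)"
    have y: "int y = x mod int N" using N by (simp add: y_def)
    have "\<psi> s x = (\<Sum>r<d. f r x * \<psi> s (int r))" if s: "s \<in> {1..k'}" for s
    proof -
      have per: "has_period (\<psi> s) (n' s)" using sys s by (simp add: periodic_system_def)
      then have "n' s > 0" by (simp add: has_period_def)
      then obtain t where t: "t \<in> {1..k}" "n' s dvd n t"
        using fraction_set_eq_imp_dvd[OF S s] pos by blast
      have "unity_poly (n' s) dvd monom 1 y - R y"
        using unity_poly_dvd[OF t(2)] L(2) t(1) dvdR by (meson dvd_trans imageI)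
      \<comment> \<open>The bound covers both the index \<open>y\<close> and every index below
        \<open>d\<close>.\<close>
      moreover define B where "B = y + d"
      have "degree (monom 1 y - R y) \<le> B"
        using degree_diff_le_max[of "monom 1 y" "R y"] degR[of y]
          degree_monom_le[of "1::int" y] unfolding B_def by linarith
      ultimately have "0 = (\<Sum>i\<le>B. coeff (monom 1 y - R y) i * \<psi> s (int i))"
        by (rule sum_coeff_periodic_eq_0[OF per, symmetric])
      \<comment> \<open>The monomial picks out \<open>\<psi> s (int y)\<close>, and the remainder
        involves only initial values.\<close>
      also have "\<dots> = (\<Sum>i\<le>B. (if i = y then \<psi> s (int i) else 0))
          - (\<Sum>i\<le>B. coeff (R y) i * \<psi> s (int i))"
        unfolding sum_subtractf[symmetric]
        by (intro sum.cong) (auto simp: left_diff_distrib)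
      also have "(\<Sum>i\<le>B. (if i = y then \<psi> s (int i) else 0)) = \<psi> s (int y)"
        by (simp add: B_def)
      also have "(\<Sum>i\<le>B. coeff (R y) i * \<psi> s (int i)) = (\<Sum>r<d. coeff (R y) r * \<psi> s (int r))"
        using degR[of y] by (intro sum.mono_neutral_right) (auto simp: B_def coeff_eq_0)
      also have "\<psi> s (int y) = \<psi> s x"
        unfolding y
      proof (rule has_period_mod[OF per])
        have "n t dvd N" using t(1) by (simp add: N_def dvd_prodI)
        with t(2) show "n' s dvd N" by (rule dvd_trans)
      qed
      finally show ?thesis by (simp add: f_def y_def)
    qed
    then have "total_map k' \<psi> x = (\<Sum>s=1..k'. \<Sum>r<d. f r x * \<psi> s (int r))"
      by (simp add: total_map_def)
    also have "\<dots> = (\<Sum>r<d. f r x * total_map k' \<psi> (int r))"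
      unfolding total_map_def sum_distrib_left by (rule sum.swap)
    finally show ?thesis .
  qed
  ultimately show ?thesis unfolding is_coefficient_family_def d_def by blast
qed

section \<open>Integer multiples and the passage to arbitrary abelian groups\<close>

lemma int_multiple_0_left [simp]: "int_multiple 0 g = 0"
  by (simp add: int_multiple_def)

lemma int_multiple_1_left [simp]: "int_multiple 1 g = g"
  by (simp add: int_multiple_def)

lemma int_multiple_0_right [simp]: "int_multiple a 0 = 0"
  by (simp add: int_multiple_def)

lemma int_multiple_add_right: "int_multiple a (g + h) = int_multiple a g + int_multiple a h"
  by (simp add: int_multiple_def sum.distrib)

lemma int_multiple_sum_right: "int_multiple a (\<Sum>i\<in>I. g i) = (\<Sum>i\<in>I. int_multiple a (g i))"
  by (induction I rule: infinite_finite_induct) (auto simp: int_multiple_add_right)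

lemma int_multiple_add_1: "int_multiple (a + 1) g = int_multiple a g + g"
proof (cases "a \<ge> 0")
  case True
  then show ?thesis by (simp add: int_multiple_def nat_add_distrib)
next
  case False
  then have "nat (- a) = Suc (nat (- (a + 1)))" by simp
  then show ?thesis using False by (simp add: int_multiple_def)
qed

lemma int_multiple_add_left: "int_multiple (a + b) g = int_multiple a g + int_multiple b g"
proof (induction b rule: int_induct[where k = 0])
  case (step2 b)
  then show ?case
    using int_multiple_add_1[of "b - 1" g] int_multiple_add_1[of "a + (b - 1)" g]
    by (simp add: algebra_simps)
qed (simp_all add: int_multiple_add_1 add.assoc[symmetric])

lemma int_multiple_sum_left: "int_multiple (\<Sum>i\<in>I. a i) g = (\<Sum>i\<in>I. int_multiple (a i) g)"
  by (induction I rule: infinite_finite_induct) (auto simp: int_multiple_add_left)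

text \<open>A periodic \<open>g\<close> is the sum over residues \<open>a\<close> of the indicator
  of \<open>a\<close> weighted by \<open>g a\<close>, so an integer identity between the indicators
  carries over to \<open>g\<close>.\<close>

lemma has_period_eq_of_residues:
  fixes g :: "int \<Rightarrow> 'g::ab_group_add"
  assumes g: "has_period g m"
    and c: "\<And>a. of_bool (x mod int m = a) = (\<Sum>r<d. c r * of_bool (int r mod int m = a))"
  shows "g x = (\<Sum>r<d. int_multiple (c r) (g (int r)))"
proof -
  let ?A = "{0..<int m}"
  have m: "m > 0" using g by (simp add: has_period_def)
  \<comment> \<open>The scalar \<open>b\<close> is included so that it serves for both the
    coefficients \<open>c r\<close> and, with \<open>b = 1\<close>, the value
    \<open>g x\<close>.\<close>
  have expand: "int_multiple b (g z) = (\<Sum>a\<in>?A. int_multiple (b * of_bool (z mod int m = a)) (g a))"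
    for b z
  proof -
    have "(\<Sum>a\<in>?A. int_multiple (b * of_bool (z mod int m = a)) (g a))
        = (\<Sum>a\<in>?A. if z mod int m = a then int_multiple b (g a) else 0)"
      by (intro sum.cong) auto
    also have "\<dots> = int_multiple b (g (z mod int m))" using m by simp
    finally show ?thesis using has_period_mod[OF g dvd_refl] by simp
  qed
  have "(\<Sum>r<d. int_multiple (c r) (g (int r)))
      = (\<Sum>r<d. \<Sum>a\<in>?A. int_multiple (c r * of_bool (int r mod int m = a)) (g a))"
    by (intro sum.cong refl expand)
  also have "\<dots> = (\<Sum>a\<in>?A. \<Sum>r<d. int_multiple (c r * of_bool (int r mod int m = a)) (g a))"
    by (rule sum.swap)
  also have "\<dots> = (\<Sum>a\<in>?A. int_multiple (of_bool (x mod int m = a)) (g a))"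
    by (simp only: int_multiple_sum_left[symmetric] c[symmetric])
  also have "\<dots> = g x" using expand[of 1 x] by simp
  finally show ?thesis by simp
qed

text \<open>Coefficients that work for the integer-valued indicators of residue classes
  work for every group, since these indicators generate all periodic maps.\<close>

lemma coefficient_family_group:
  fixes \<psi> :: "nat \<Rightarrow> int \<Rightarrow> 'g::ab_group_add"
  assumes f: "is_coefficient_family (fraction_set k n) f"
    and sys: "periodic_system k n \<psi>"
  shows "total_map k \<psi> x =
    (\<Sum>r<card (fraction_set k n). int_multiple (f r x) (total_map k \<psi> (int r)))"
proof -
  define d where "d = card (fraction_set k n)"
  have "\<psi> s x = (\<Sum>r<d. int_multiple (f r x) (\<psi> s (int r)))" if s: "s \<in> {1..k}" for s
  proof (rule has_period_eq_of_residues[where m = "n s"])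
    show "has_period (\<psi> s) (n s)" using sys s by (simp add: periodic_system_def)
    fix a
    \<comment> \<open>The residue indicator sits in component \<open>s\<close> and all other
      components vanish. The periods are unchanged, so the same family applies, and the total is the
      indicator itself.\<close>
    define \<eta> :: "nat \<Rightarrow> int \<Rightarrow> int"
      where "\<eta> t z = (if t = s then of_bool (z mod int (n s) = a) else 0)" for t z
    have "periodic_system k n \<eta>"
      using sys by (auto simp: periodic_system_def has_period_def periodic_fun_simple_def \<eta>_def)
    then have "total_map k \<eta> x = (\<Sum>r<d. f r x * total_map k \<eta> (int r))"
      using f unfolding is_coefficient_family_def d_def by blast
    moreover have "total_map k \<eta> z = of_bool (z mod int (n s) = a)" for z
      using s by (simp add: total_map_def \<eta>_def)
    ultimately show "of_bool (x mod int (n s) = a)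
        = (\<Sum>r<d. f r x * of_bool (int r mod int (n s) = a))"
      by (simp only:)
  qed
  then have "total_map k \<psi> x = (\<Sum>s=1..k. \<Sum>r<d. int_multiple (f r x) (\<psi> s (int r)))"
    by (simp add: total_map_def)
  also have "\<dots> = (\<Sum>r<d. int_multiple (f r x) (total_map k \<psi> (int r)))"
    unfolding total_map_def int_multiple_sum_right by (rule sum.swap)
  finally show ?thesis unfolding d_def .
qed

section \<open>The chosen family, constancy, and the combined result\<close>

lemma periodic_system_pos:
  assumes "periodic_system k n \<psi>"
  shows "k \<ge> 1" "\<And>s. s \<in> {1..k} \<Longrightarrow> n s > 0"
  using assms by (auto simp: periodic_system_def has_period_def)

lemma is_coefficient_family_coefficient_maps:
  assumes "k \<ge> 1" "\<And>s. s \<in> {1..k} \<Longrightarrow> n s > 0"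
  shows "is_coefficient_family (fraction_set k n) (coefficient_maps (fraction_set k n))"
  unfolding coefficient_maps_def is_coefficient_family_def[symmetric]
  using ex_coefficient_family[OF assms] by (rule someI_ex)

lemma total_map_constant:
  fixes \<psi> :: "nat \<Rightarrow> int \<Rightarrow> 'g::ab_group_add"
  assumes sys: "periodic_system k n \<psi>"
    and c: "\<And>x. x \<in> {a ..< a + int (card (fraction_set k n))} \<Longrightarrow> total_map k \<psi> x = c"
  shows "total_map k \<psi> x = c"
proof -
  \<comment> \<open>The shift moves the start of the window from \<open>a\<close> to 0. Subtracting
    \<open>c\<close> in component 1 only, which exists as \<open>k \<ge> 1\<close>, lowers the total
    by exactly \<open>c\<close>.\<close>
  define \<phi> where "\<phi> s z = \<psi> s (z + a) - (if s = 1 then c else 0)" for s z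
  note pos = periodic_system_pos[OF sys]
  have "\<phi> s (z + int (n s)) = \<phi> s z" if "s \<in> {1..k}" for s z
  proof -
    have "z + int (n s) + a = (z + a) + int (n s)" by simp
    moreover have "\<psi> s (w + int (n s)) = \<psi> s w" for w
      using sys that unfolding periodic_system_def has_period_def periodic_fun_simple_def by blast
    ultimately show ?thesis by (simp only: \<phi>_def)
  qed
  then have \<phi>: "periodic_system k n \<phi>"
    using pos by (simp add: periodic_system_def has_period_def periodic_fun_simple_def)
  have tot: "total_map k \<phi> z = total_map k \<psi> (z + a) - c" for z
    using pos(1) by (simp add: total_map_def \<phi>_def sum_subtractf)
  then have "total_map k \<phi> (int r) = 0" if "r < card (fraction_set k n)" for r
    using c that by simp
  moreover have "is_coefficient_family (fraction_set k n) (coefficient_maps (fraction_set k n))"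
    using pos by (rule is_coefficient_family_coefficient_maps)
  \<comment> \<open>All initial values of the new total vanish, hence so does every combination of
    them.\<close>
  ultimately have "total_map k \<phi> (x - a) = 0"
    by (subst coefficient_family_group[OF _ \<phi>]) simp_all
  then show ?thesis by (simp add: tot)
qed

theorem theorem1p1:
  fixes \<psi> :: "nat \<Rightarrow> int \<Rightarrow> 'g::ab_group_add" and n :: "nat \<Rightarrow> nat" and k :: nat
  assumes "periodic_system k n \<psi>"
  shows
    "(\<forall>r < card (fraction_set k n). periodic_map (coefficient_maps (fraction_set k n) r)) \<and>
     (\<forall>x. total_map k \<psi> x =
        (\<Sum>r < card (fraction_set k n).
           int_multiple (coefficient_maps (fraction_set k n) r x) (total_map k \<psi> (int r)))) \<and>
     (\<forall>k' n' (\<psi>' :: nat \<Rightarrow> int \<Rightarrow> 'g).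
        periodic_system k' n' \<psi>' \<and> fraction_set k' n' = fraction_set k n \<and>
        (\<forall>r < card (fraction_set k n). total_map k' \<psi>' (int r) = total_map k \<psi> (int r)) \<longrightarrow>
        total_map k' \<psi>' = total_map k \<psi>) \<and>
     ((\<exists>a. total_map k \<psi> constant_on {a ..< a + int (card (fraction_set k n))}) \<longrightarrow>
        total_map k \<psi> constant_on UNIV) \<and>
     int (card (fraction_set k n)) \<le> (\<Sum>s=1..k. int (n s)) - int k + 1"
proof -
  note pos = periodic_system_pos[OF assms]
  have f: "is_coefficient_family (fraction_set k n) (coefficient_maps (fraction_set k n))"
    using pos by (rule is_coefficient_family_coefficient_maps)
  \<comment> \<open>Stated for any system with the same fraction set, so that two systems can be
    compared through the same coefficients.\<close>
  have eq: "total_map k' \<psi>' x = (\<Sum>r < card (fraction_set k n).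
      int_multiple (coefficient_maps (fraction_set k n) r x) (total_map k' \<psi>' (int r)))"
    if "periodic_system k' n' \<psi>'" "fraction_set k' n' = fraction_set k n"
    for k' n' x and \<psi>' :: "nat \<Rightarrow> int \<Rightarrow> 'g"
    using coefficient_family_group[of k' n'] f that by simp
  show ?thesis
  proof (intro conjI)
    show "\<forall>r < card (fraction_set k n). periodic_map (coefficient_maps (fraction_set k n) r)"
      using f by (simp add: is_coefficient_family_def)
    show "\<forall>x. total_map k \<psi> x = (\<Sum>r < card (fraction_set k n).
        int_multiple (coefficient_maps (fraction_set k n) r x) (total_map k \<psi> (int r)))"
      using eq[OF assms refl] by blast
    show "\<forall>k' n' (\<psi>' :: nat \<Rightarrow> int \<Rightarrow> 'g).
        periodic_system k' n' \<psi>' \<and> fraction_set k' n' = fraction_set k n \<and>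
        (\<forall>r < card (fraction_set k n). total_map k' \<psi>' (int r) = total_map k \<psi> (int r)) \<longrightarrow>
        total_map k' \<psi>' = total_map k \<psi>"
    proof (intro allI impI ext, elim conjE)
      fix k' n' x and \<psi>' :: "nat \<Rightarrow> int \<Rightarrow> 'g"
      assume "periodic_system k' n' \<psi>'" "fraction_set k' n' = fraction_set k n"
        and "\<forall>r < card (fraction_set k n). total_map k' \<psi>' (int r) = total_map k \<psi> (int r)"
      then show "total_map k' \<psi>' x = total_map k \<psi> x"
        unfolding eq[OF assms refl, of x] by (subst eq) auto
    qed
    show "(\<exists>a. total_map k \<psi> constant_on {a ..< a + int (card (fraction_set k n))}) \<longrightarrow>
        total_map k \<psi> constant_on UNIV"
      unfolding constant_on_def using total_map_constant[OF assms] by blast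
    show "int (card (fraction_set k n)) \<le> (\<Sum>s=1..k. int (n s)) - int k + 1"
      using pos by (rule card_fraction_set_le)
  qed
qed

end
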